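(* Let $E,F$ be real normed linear spaces, and let $U\subseteq E$, $V\subseteq F$. Assume either that $U,V$ are open sets and $U$ is connected, or that both $U,V$ are convex bodies. Let $\varphi:V\to U$ and $h:V\to\mathbb{R}$ be maps such that the weighted composition operator $Tf=h\cdot (f\circ\varphi)$ defines a bijection from $\mathrm{Lip}(U)$ onto $\mathrm{Lip}(V)$ with $L(Tf)=L(f)$ for all $f\in\mathrm{Lip}(U)$. Then there are a linear isometry $A:F\to E$ with dense range, a scalar $\alpha>0$ and a vector $b\in E$ such that $\varphi(y)=\alpha Ay+b$ for all $y\in V$, and $h$ is a constant function with value $\alpha^{-1}$ or $-\alpha^{-1}$. In other words, for a fixed choice of sign, $$Tf(y)=\pm\alpha^{-1}f(\alpha Ay+b)\quad\text{for all } f\in\mathrm{Lip}(U)\text{ and all } y\in V.$$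
   Context: All vector spaces are over $\mathbb{R}$. Subsets of normed spaces carry the metric induced by the norm. For a metric space $(X,d_X)$ and $f:X\to\mathbb{R}$, $L(f)=\sup_{x\neq y\in X}\frac{|f(x)-f(y)|}{d_X(x,y)}$, and $\mathrm{Lip}(X)$ is the real vector space of all $f:X\to\mathbb{R}$ with $L(f)<+\infty$. A convex body in a normed linear space is a (not necessarily closed or bounded) convex set with nonempty interior. An isometry is a distance-preserving map (not assumed surjective). *)

theory Defs
  imports "HOL-Analysis.Analysis"
begin

text \<open>
  Valued in \<^typ>\<open>ennreal\<close>, so that the supremum always exists and is \<open>0\<close> when \<open>X\<close> has at most
  one point.
\<close>

definition Lip_const :: "'a::metric_space set \<Rightarrow> ('a \<Rightarrow> real) \<Rightarrow> ennreal" where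
  "Lip_const X f = (SUP (x, y) \<in> {(x, y). x \<in> X \<and> y \<in> X \<and> x \<noteq> y}. ennreal (\<bar>f x - f y\<bar> / dist x y))"

text \<open>
  Real functions on \<open>X\<close> are represented by their extensional extensions (\<^const>\<open>undefined\<close>
  outside \<open>X\<close>), so that equality in \<open>Lip X\<close> is equality on \<open>X\<close>.
\<close>

definition Lip :: "'a::metric_space set \<Rightarrow> ('a \<Rightarrow> real) set" where
  "Lip X = {f \<in> extensional X. Lip_const X f < \<infinity>}"

definition weighted_comp :: "'b set \<Rightarrow> ('b \<Rightarrow> real) \<Rightarrow> ('b \<Rightarrow> 'a) \<Rightarrow> ('a \<Rightarrow> real) \<Rightarrow> 'b \<Rightarrow> real" where
  "weighted_comp V h \<phi> f = (\<lambda>y\<in>V. h y * f (\<phi> y))"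

definition convex_body :: "'a::real_normed_vector set \<Rightarrow> bool" where
  "convex_body S \<longleftrightarrow> convex S \<and> interior S \<noteq> {}"

end

theory Submission
  imports Defs
begin

text \<open>
  Testing the isometry on constants shows that \<open>h\<close> is a constant \<open>c \<noteq> 0\<close>; testing it on distance
  functions on both sides shows \<open>dist (\<phi> x) (\<phi> y) = dist x y / \<bar>c\<bar>\<close>; and injectivity, applied to the
  distance from \<open>\<phi> ` V\<close>, shows that \<open>\<phi> ` V\<close> is dense in \<open>U\<close>. Near an interior point of \<open>V\<close> mapped to
  the interior of \<open>U\<close>, an approximate form of the reflection proof of the Mazur--Ulam theorem makes \<open>\<phi>\<close>
  affine without passing to completions.

  The affine formula then spreads over the interior of \<open>U\<close>, even though \<open>V\<close> need not be connected and
  \<open>\<phi>\<close> need not be onto: a point at distance less than \<open>11/10 r\<close> from the centre of a ball of radius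
  \<open>r\<close> is determined by its distances to the points of that ball, so the formula passes from a ball to a
  ball larger by a fixed factor. Hence the set of centres around which it holds is open and closed.
\<close>

subsection \<open>A Mazur--Ulam theorem for isometries with dense range\<close>

text \<open>
  An isometry whose range is merely dense has an inverse only up to an error \<open>\<epsilon>\<close>, so relations
  replace maps. The points \<open>a\<close> and \<open>b\<close> are fixed, and the condition \<open>dist x a < R - \<epsilon> \<and> dist x b < R - \<epsilon>\<close>
  describes a region that is symmetric under the reflection \<open>x \<mapsto> a + b - x\<close> and that \<open>\<Gamma>\<close> preserves up to
  another \<open>\<epsilon>\<close>.
\<close>

definition almost_isometry :: "'a::real_normed_vector \<Rightarrow> 'a \<Rightarrow> real \<Rightarrow> real \<Rightarrow> ('a \<times> 'a) set \<Rightarrow> bool" where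
  "almost_isometry a b R \<epsilon> \<Gamma> \<longleftrightarrow>
     (a, a) \<in> \<Gamma> \<and> (b, b) \<in> \<Gamma> \<and>
     (\<forall>(x, u)\<in>\<Gamma>. \<forall>(y, v)\<in>\<Gamma>. \<bar>dist x y - dist u v\<bar> \<le> \<epsilon>) \<and>
     (\<forall>x. dist x a < R - \<epsilon> \<and> dist x b < R - \<epsilon> \<longrightarrow> (\<exists>u. (x, u) \<in> \<Gamma>) \<and> (\<exists>u. (u, x) \<in> \<Gamma>))"

lemma almost_isometryD:
  assumes "almost_isometry a b R \<epsilon> \<Gamma>"
  shows "(a, a) \<in> \<Gamma>" "(b, b) \<in> \<Gamma>"
    and "(x, u) \<in> \<Gamma> \<Longrightarrow> (y, v) \<in> \<Gamma> \<Longrightarrow> \<bar>dist x y - dist u v\<bar> \<le> \<epsilon>"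
    and "dist x a < R - \<epsilon> \<Longrightarrow> dist x b < R - \<epsilon> \<Longrightarrow> \<exists>u. (x, u) \<in> \<Gamma>"
    and "dist x a < R - \<epsilon> \<Longrightarrow> dist x b < R - \<epsilon> \<Longrightarrow> \<exists>u. (u, x) \<in> \<Gamma>"
  using assms unfolding almost_isometry_def by blast+

text \<open>Each of the two passes through \<open>\<Gamma>\<close> costs one \<epsilon> in the
  distances. The first pass may also bring a point closer by \<epsilon> to the boundary of the
  admissible region, so starting in the region for \<open>2 * \<epsilon>\<close> leaves room for the
  second; reflection merely exchanges the distances to \<open>a\<close> and
  \<open>b\<close>.\<close>

lemma almost_isometry_reflect:
  fixes a b :: "'a::real_normed_vector"
  assumes \<Gamma>: "almost_isometry a b R \<epsilon> \<Gamma>"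
  shows "almost_isometry a b R (2 * \<epsilon>)
    {(x, w). \<exists>s. (x, s) \<in> \<Gamma> \<and> (a + b - w, a + b - s) \<in> \<Gamma>}" (is "almost_isometry a b R _ ?\<Delta>")
proof -
  note D = almost_isometryD[OF \<Gamma>]
  have refl: "dist (a + b - x) (a + b - y) = dist x y" for x y
    by (simp add: dist_norm norm_minus_commute)
  have refla: "dist (a + b - x) a = dist x b" "dist (a + b - x) b = dist x a" for x
    by (simp_all add: dist_norm norm_minus_commute)
  have dist\<Delta>: "\<bar>dist x y - dist u v\<bar> \<le> 2 * \<epsilon>" if xu: "(x, u) \<in> ?\<Delta>" and yv: "(y, v) \<in> ?\<Delta>" for x u y v
  proof -
    from xu yv obtain s t where "(x, s) \<in> \<Gamma>" "(a + b - u, a + b - s) \<in> \<Gamma>"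
      "(y, t) \<in> \<Gamma>" "(a + b - v, a + b - t) \<in> \<Gamma>"
      by auto
    then have "\<bar>dist x y - dist s t\<bar> \<le> \<epsilon>" "\<bar>dist u v - dist s t\<bar> \<le> \<epsilon>"
      using D(3)[of x s y t] D(3)[of "a + b - u" "a + b - s" "a + b - v" "a + b - t"]
      by (simp_all add: refl)
    then show ?thesis
      by linarith
  qed
  have ex: "(\<exists>u. (x, u) \<in> ?\<Delta>) \<and> (\<exists>u. (u, x) \<in> ?\<Delta>)"
    if xa: "dist x a < R - 2 * \<epsilon>" and xb: "dist x b < R - 2 * \<epsilon>" for x
  proof -
    have "0 \<le> \<epsilon>"
      using D(3)[OF D(1) D(1)] by simp
    then have x: "dist x a < R - \<epsilon>" "dist x b < R - \<epsilon>"
      using xa xb by linarith+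
    obtain s where s: "(x, s) \<in> \<Gamma>"
      using D(4)[OF x] by blast
    have "dist s a < R - \<epsilon>" "dist s b < R - \<epsilon>"
      using D(3)[OF s D(1)] D(3)[OF s D(2)] xa xb by linarith+
    then obtain t where t: "(t, a + b - s) \<in> \<Gamma>"
      using D(5)[of "a + b - s"] by (auto simp: refla)
    have "(x, a + b - t) \<in> ?\<Delta>"
      using s t by auto
    moreover
    obtain s' where s': "(a + b - x, s') \<in> \<Gamma>"
      using D(4)[of "a + b - x"] x by (auto simp: refla)
    have "dist s' a < R - \<epsilon>" "dist s' b < R - \<epsilon>"
      using D(3)[OF s' D(1)] D(3)[OF s' D(2)] xa xb unfolding refla by linarith+
    then obtain t' where t': "(t', a + b - s') \<in> \<Gamma>"
      using D(5)[of "a + b - s'"] by (auto simp: refla)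
    have "(t', x) \<in> ?\<Delta>"
      using s' t' by auto
    ultimately show ?thesis
      by blast
  qed
  have "(a, a) \<in> ?\<Delta>" "(b, b) \<in> ?\<Delta>"
    using D(1,2) by auto
  with dist\<Delta> ex show ?thesis
    unfolding almost_isometry_def by blast
qed

text \<open>
  The relation of the preceding lemma is \<open>\<pi> \<circ> \<Gamma>\<inverse> \<circ> \<pi> \<circ> \<Gamma>\<close> for the reflection \<open>\<pi>\<close>; it moves the midpoint
  about twice as far as \<open>\<Gamma>\<close> does.
\<close>

lemma almost_isometry_midpoint_step:
  fixes a b :: "'a::real_normed_vector"
  assumes R: "dist a b / 2 < R" and "c > 0" and "\<epsilon> > 0"
    and IH: "\<And>\<Gamma> \<epsilon>' u. \<lbrakk>almost_isometry a b R \<epsilon>' \<Gamma>; \<epsilon>' \<le> \<epsilon>; (midpoint a b, u) \<in> \<Gamma>\<rbrakk>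
      \<Longrightarrow> dist u (midpoint a b) \<le> c"
  shows "\<exists>\<epsilon>>0. \<forall>\<Gamma> \<epsilon>' u. almost_isometry a b R \<epsilon>' \<Gamma> \<longrightarrow> \<epsilon>' \<le> \<epsilon> \<longrightarrow> (midpoint a b, u) \<in> \<Gamma>
      \<longrightarrow> dist u (midpoint a b) \<le> 3/4 * c"
proof -
  \<comment> \<open>The first bound makes \<open>IH\<close> applicable to the reflected relation,
    whose error is \<open>2 * \<epsilon>'\<close>; the second yields
    \<open>(c + c / 2) / 2 = 3/4 * c\<close>; the third keeps \<open>u\<close> inside the region
    where preimages exist.\<close>
  define \<delta> where "\<delta> = min (\<epsilon> / 2) (min (c / 2) ((R - dist a b / 2) / 3))"
  let ?m = "midpoint a b"
  have \<delta>: "\<delta> > 0" "2 * \<delta> \<le> \<epsilon>" "\<delta> \<le> c / 2" "3 * \<delta> \<le> R - dist a b / 2"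
    using assms by (auto simp: \<delta>_def min_def)
  have "dist u ?m \<le> 3/4 * c"
    if \<Gamma>: "almost_isometry a b R \<epsilon>' \<Gamma>" and "\<epsilon>' \<le> \<delta>" and u: "(?m, u) \<in> \<Gamma>" for \<Gamma> \<epsilon>' u
  proof -
    note D = almost_isometryD[OF \<Gamma>]
    have "dist u a < R - \<epsilon>'" "dist u b < R - \<epsilon>'"
      using D(3)[OF u D(1)] D(3)[OF u D(2)] \<open>\<epsilon>' \<le> \<delta>\<close> \<delta> by (simp_all add: dist_midpoint)
    moreover have "dist (a + b - u) a = dist u b" "dist (a + b - u) b = dist u a"
      by (simp_all add: dist_norm norm_minus_commute)
    ultimately obtain t where t: "(t, a + b - u) \<in> \<Gamma>"
      using D(5)[of "a + b - u"] by auto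
    \<comment> \<open>The reflected relation pairs the midpoint with \<open>a + b - t\<close>,
      through the intermediate point \<open>u\<close>. So \<open>c\<close> bounds
      \<open>dist t ?m\<close>, which is within \<epsilon>' of twice the displacement of
      \<open>u\<close>.\<close>
    have "dist (a + b - t) ?m \<le> c"
      using u t \<open>\<epsilon>' \<le> \<delta>\<close> \<delta>
      by (intro IH[OF almost_isometry_reflect[OF \<Gamma>]]) auto
    moreover have "dist (a + b - t) ?m = dist t ?m"
    proof -
      have "a + b - t - ?m = ?m - t"
        by (simp add: midpoint_def algebra_simps flip: scaleR_add_left)
      then show ?thesis
        by (metis dist_commute dist_norm)
    qed
    moreover have "dist (a + b - u) u = 2 * dist u ?m"
    proof -
      have "a + b - u - u = (-2) *\<^sub>R (u - ?m)"
        by (simp add: midpoint_def algebra_simps scaleR_2)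
      then show ?thesis
        by (simp add: dist_norm)
    qed
    moreover have "\<bar>dist t ?m - dist (a + b - u) u\<bar> \<le> \<epsilon>'"
      by (rule D(3)[OF t u])
    ultimately show ?thesis
      using \<open>\<epsilon>' \<le> \<delta>\<close> \<delta> by linarith
  qed
  with \<delta>(1) show ?thesis
    by blast
qed

text \<open>Starting from a trivial bound, the preceding step gains a factor 3/4 each time. The
  tolerance depends on the number of steps but not on \<open>\<Gamma>\<close>, and finitely many
  steps bring the bound below \<open>c\<close>.\<close>

lemma almost_isometry_midpoint:
  fixes a b :: "'a::real_normed_vector"
  assumes R: "dist a b / 2 < R" and "c > 0"
  shows "\<exists>\<epsilon>>0. \<forall>\<Gamma> \<epsilon>' u. almost_isometry a b R \<epsilon>' \<Gamma> \<longrightarrow> \<epsilon>' \<le> \<epsilon> \<longrightarrow> (midpoint a b, u) \<in> \<Gamma>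
      \<longrightarrow> dist u (midpoint a b) \<le> c"
proof -
  define M where "M = dist a b + 1"
  have "\<exists>\<epsilon>>0. \<forall>\<Gamma> \<epsilon>' u. almost_isometry a b R \<epsilon>' \<Gamma> \<longrightarrow> \<epsilon>' \<le> \<epsilon> \<longrightarrow> (midpoint a b, u) \<in> \<Gamma>
      \<longrightarrow> dist u (midpoint a b) \<le> (3/4) ^ n * M" for n
  proof (induction n)
    case 0
    have "dist u (midpoint a b) \<le> M"
      if \<Gamma>: "almost_isometry a b R \<epsilon>' \<Gamma>" and "\<epsilon>' \<le> 1" and u: "(midpoint a b, u) \<in> \<Gamma>" for \<Gamma> \<epsilon>' u
    proof -
      have "\<bar>dist (midpoint a b) a - dist u a\<bar> \<le> \<epsilon>'"
        using almost_isometryD(1,3)[OF \<Gamma>] u by blast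
      then show ?thesis
        using dist_triangle[of u "midpoint a b" a] \<open>\<epsilon>' \<le> 1\<close>
        by (simp add: dist_midpoint dist_commute M_def)
    qed
    then show ?case
      by (intro exI[of _ 1]) auto
  next
    case (Suc n)
    then obtain \<epsilon> where "\<epsilon> > 0" and "\<And>\<Gamma> \<epsilon>' u. \<lbrakk>almost_isometry a b R \<epsilon>' \<Gamma>; \<epsilon>' \<le> \<epsilon>; (midpoint a b, u) \<in> \<Gamma>\<rbrakk>
        \<Longrightarrow> dist u (midpoint a b) \<le> (3/4) ^ n * M"
      by blast
    moreover have "(3/4) ^ n * M > 0"
      by (simp add: M_def add_nonneg_pos)
    ultimately show ?case
      using almost_isometry_midpoint_step[OF R, of "(3/4) ^ n * M" \<epsilon>] by (simp add: mult.assoc)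
  qed
  moreover obtain n where "(3/4) ^ n < c / M"
    using real_arch_pow_inv[of "c / M" "3/4"] \<open>c > 0\<close> by (auto simp: M_def add_nonneg_pos)
  then have "(3/4) ^ n * M \<le> c"
    by (simp add: pos_less_divide_eq M_def add_nonneg_pos)
  ultimately show ?thesis
    by (meson order_trans)
qed

text \<open>For \<psi> onto, one could apply \<psi>, reflect in the midpoint of
  \<open>\<psi> a\<close> and \<open>\<psi> b\<close>, pull back and reflect again: an isometry
  fixing \<open>a\<close> and \<open>b\<close>. \<open>\<Gamma>\<close> is its approximate version
  for a dense range; that it almost fixes the midpoint forces twice the image of the midpoint to be
  close to \<open>\<psi> a + \<psi> b\<close>.\<close>

lemma dense_isometry_midpoint:
  fixes \<psi> :: "'a::real_normed_vector \<Rightarrow> 'b::real_normed_vector"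
  assumes iso: "\<And>x y. x \<in> V \<Longrightarrow> y \<in> V \<Longrightarrow> dist (\<psi> x) (\<psi> y) = dist x y"
    and "a \<in> V" "b \<in> V" and R: "dist a b / 2 < R"
    and V: "\<And>x. dist x a < R \<Longrightarrow> dist x b < R \<Longrightarrow> x \<in> V"
    and refl: "\<And>x. dist x a < R \<Longrightarrow> dist x b < R \<Longrightarrow> \<psi> a + \<psi> b - \<psi> x \<in> closure (\<psi> ` V)"
  shows "\<psi> (midpoint a b) = midpoint (\<psi> a) (\<psi> b)"
proof -
  let ?m = "midpoint a b"
  have m: "dist ?m a < R" "dist ?m b < R"
    using R by (simp_all add: dist_midpoint)
  have bound: "dist (\<psi> a + \<psi> b) (2 *\<^sub>R \<psi> ?m) \<le> 2 * c" if "c > 0" for c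
  proof -
    obtain \<epsilon>0 where "\<epsilon>0 > 0" and \<epsilon>0: "\<And>\<Gamma> \<epsilon>' u. \<lbrakk>almost_isometry a b R \<epsilon>' \<Gamma>; \<epsilon>' \<le> \<epsilon>0; (?m, u) \<in> \<Gamma>\<rbrakk>
        \<Longrightarrow> dist u ?m \<le> c"
      using almost_isometry_midpoint[OF R \<open>c > 0\<close>] by blast
    \<comment> \<open>Two approximations enter each comparison of distances, so
      \<open>\<Gamma>\<close> has error \<open>2 * \<epsilon>\<close>;
      \<open>\<epsilon> \<le> c\<close> turns the final estimate \<open>c + \<epsilon>\<close> into
      \<open>2 * c\<close>.\<close>
    define \<epsilon> where "\<epsilon> = min (\<epsilon>0 / 2) c"
    have \<epsilon>: "\<epsilon> > 0" "2 * \<epsilon> \<le> \<epsilon>0" "\<epsilon> \<le> c"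
      using \<open>\<epsilon>0 > 0\<close> \<open>c > 0\<close> by (auto simp: \<epsilon>_def)
    define \<Gamma> where "\<Gamma> = {(x, w). x \<in> V \<and> a + b - w \<in> V \<and>
      dist (\<psi> a + \<psi> b - \<psi> x) (\<psi> (a + b - w)) < \<epsilon>}"
    have near: "\<exists>y\<in>V. dist (\<psi> a + \<psi> b - \<psi> x) (\<psi> y) < \<epsilon>" if "dist x a < R" "dist x b < R" for x
      using refl[OF that] \<epsilon>(1) by (auto simp: closure_approachable dist_commute)
    \<comment> \<open>By this symmetry the condition defining \<open>\<Gamma>\<close> is unchanged
      when \<open>x\<close> and \<open>a + b - w\<close> trade places, so one density assumption
      yields both images and preimages.\<close>
    have swap: "dist (\<psi> a + \<psi> b - p) q = dist (\<psi> a + \<psi> b - q) p" for p q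
      by (simp add: dist_norm algebra_simps)
    have ex1: "\<exists>u. (x, u) \<in> \<Gamma>" if x: "dist x a < R" "dist x b < R" for x
    proof -
      obtain y where "y \<in> V" "dist (\<psi> a + \<psi> b - \<psi> x) (\<psi> y) < \<epsilon>"
        using near[OF x] by blast
      then have "(x, a + b - y) \<in> \<Gamma>"
        using V[OF x] by (simp add: \<Gamma>_def)
      then show ?thesis ..
    qed
    have ex2: "\<exists>u. (u, w) \<in> \<Gamma>" if w: "dist w a < R" "dist w b < R" for w
    proof -
      have w': "dist (a + b - w) a < R" "dist (a + b - w) b < R"
        using w by (simp_all add: dist_norm norm_minus_commute)
      obtain y where "y \<in> V" "dist (\<psi> a + \<psi> b - \<psi> (a + b - w)) (\<psi> y) < \<epsilon>"
        using near[OF w'] by blast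
      then have "(y, w) \<in> \<Gamma>"
        using V[OF w'] swap[of "\<psi> y"] by (simp add: \<Gamma>_def)
      then show ?thesis ..
    qed
    have dist\<Gamma>: "\<bar>dist x y - dist u v\<bar> \<le> 2 * \<epsilon>" if xu: "(x, u) \<in> \<Gamma>" and yv: "(y, v) \<in> \<Gamma>" for x u y v
    proof -
      let ?p = "\<psi> a + \<psi> b - \<psi> x" and ?q = "\<psi> a + \<psi> b - \<psi> y"
      have "dist x y = dist ?p ?q"
        using xu yv iso[of x y] by (simp add: \<Gamma>_def dist_norm norm_minus_commute)
      moreover have "dist u v = dist (\<psi> (a + b - u)) (\<psi> (a + b - v))"
        using xu yv iso[of "a + b - u" "a + b - v"]
        by (simp add: \<Gamma>_def dist_norm norm_minus_commute)
      moreover have "dist ?p (\<psi> (a + b - u)) < \<epsilon>" "dist ?q (\<psi> (a + b - v)) < \<epsilon>"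
        using xu yv by (auto simp: \<Gamma>_def)
      ultimately show ?thesis
        using dist_triangle[of ?p ?q "\<psi> (a + b - u)"]
          dist_triangle[of "\<psi> (a + b - u)" ?q "\<psi> (a + b - v)"]
          dist_triangle[of "\<psi> (a + b - u)" "\<psi> (a + b - v)" ?p]
          dist_triangle[of ?p "\<psi> (a + b - v)" ?q]
        by (simp add: dist_commute abs_le_iff)
    qed
    have "almost_isometry a b R (2 * \<epsilon>) \<Gamma>"
      unfolding almost_isometry_def
    proof (intro conjI)
      show "(a, a) \<in> \<Gamma>" "(b, b) \<in> \<Gamma>"
        using \<open>a \<in> V\<close> \<open>b \<in> V\<close> \<epsilon>(1) by (simp_all add: \<Gamma>_def)
      show "\<forall>(x, u)\<in>\<Gamma>. \<forall>(y, v)\<in>\<Gamma>. \<bar>dist x y - dist u v\<bar> \<le> 2 * \<epsilon>"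
        using dist\<Gamma> by blast
      show "\<forall>x. dist x a < R - 2 * \<epsilon> \<and> dist x b < R - 2 * \<epsilon> \<longrightarrow> (\<exists>u. (x, u) \<in> \<Gamma>) \<and> (\<exists>u. (u, x) \<in> \<Gamma>)"
        using ex1 ex2 \<epsilon>(1) by (auto dest!: less_le_trans[of _ "R - 2 * \<epsilon>" R])
    qed
    moreover obtain w where w: "(?m, w) \<in> \<Gamma>"
      using ex1[OF m] by blast
    ultimately have "dist w ?m \<le> c"
      using \<epsilon>0 \<epsilon>(2) by blast
    moreover have "dist ?m (a + b - w) = dist w ?m"
    proof -
      have "?m - (a + b - w) = w - ?m"
        by (simp add: midpoint_def algebra_simps flip: scaleR_add_left)
      then show ?thesis
        by (simp only: dist_norm)
    qed
    moreover have "dist (\<psi> ?m) (\<psi> (a + b - w)) = dist ?m (a + b - w)"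
      using w by (intro iso) (auto simp: \<Gamma>_def)
    ultimately have "dist (\<psi> ?m) (\<psi> (a + b - w)) \<le> c"
      by simp
    moreover have "dist (\<psi> a + \<psi> b - \<psi> ?m) (\<psi> (a + b - w)) < \<epsilon>"
      using w by (simp add: \<Gamma>_def)
    moreover have "dist (\<psi> a + \<psi> b) (2 *\<^sub>R \<psi> ?m) = dist (\<psi> a + \<psi> b - \<psi> ?m) (\<psi> ?m)"
      by (simp add: dist_norm scaleR_2 algebra_simps)
    ultimately show ?thesis
      using dist_triangle[of "\<psi> a + \<psi> b - \<psi> ?m" "\<psi> ?m" "\<psi> (a + b - w)"] \<epsilon>(3)
      by (simp add: dist_commute)
  qed
  have "dist (\<psi> a + \<psi> b) (2 *\<^sub>R \<psi> ?m) \<le> e" if "e > 0" for e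
    using bound[of "e / 2"] that by simp
  then have "\<psi> a + \<psi> b = 2 *\<^sub>R \<psi> ?m"
    by (metis dist_le_zero_iff dense_ge)
  then show ?thesis
    by (simp add: midpoint_def)
qed

subsection \<open>Local affinity\<close>

text \<open>Additivity gives homogeneity over the integers. For real \<open>t\<close>, the defect of
  homogeneity times \<open>k\<close> is the defect for the fractional part of \<open>k * t\<close>,
  hence at most \<open>2 * norm x\<close> for every \<open>k\<close>; so the defect is zero.\<close>

lemma linear_if_additive_isometry:
  fixes A :: "'a::real_normed_vector \<Rightarrow> 'b::real_normed_vector"
  assumes add: "\<And>x y. A (x + y) = A x + A y" and norm: "\<And>x. norm (A x) = norm x"
  shows "linear A"
proof (rule linearI)
  interpret additive A
    by unfold_locales (rule add)
  show "A (x + y) = A x + A y" for x y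
    by (rule add)
  have nat: "A (real n *\<^sub>R x) = real n *\<^sub>R A x" for n x
    by (induction n) (simp_all add: zero add scaleR_add_left)
  have int: "A (real_of_int j *\<^sub>R x) = real_of_int j *\<^sub>R A x" for j x
    by (cases j rule: int_cases2) (simp_all add: nat minus)
  show "A (t *\<^sub>R x) = t *\<^sub>R A x" for t x
  proof -
    let ?d = "A (t *\<^sub>R x) - t *\<^sub>R A x"
    have bound: "real k * norm ?d \<le> 2 * norm x" for k
    proof -
      define j where "j = \<lfloor>real k * t\<rfloor>"
      define s where "s = real k * t - real_of_int j"
      have s: "\<bar>s\<bar> \<le> 1"
        unfolding s_def j_def by linarith
      have kt: "real k * t = real_of_int j + s"
        by (simp add: s_def)
      have "real k *\<^sub>R ?d = A (real k *\<^sub>R (t *\<^sub>R x)) - (real k * t) *\<^sub>R A x"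
        unfolding nat by (simp add: scaleR_diff_right)
      also have "\<dots> = A (s *\<^sub>R x) - s *\<^sub>R A x"
        by (simp add: kt scaleR_add_left add int)
      finally have "real k * norm ?d = norm (A (s *\<^sub>R x) - s *\<^sub>R A x)"
        by (metis norm_scaleR abs_of_nat)
      also have "\<dots> \<le> \<bar>s\<bar> * norm x + \<bar>s\<bar> * norm x"
        using norm_triangle_ineq4[of "A (s *\<^sub>R x)" "s *\<^sub>R A x"] by (simp add: norm)
      also have "\<dots> \<le> 2 * norm x"
        using mult_right_mono[OF s norm_ge_zero[of x]] by simp
      finally show ?thesis .
    qed
    have "norm ?d = 0"
    proof (rule ccontr)
      assume "norm ?d \<noteq> 0"
      then have "norm ?d > 0"
        by simp
      then obtain k where "2 * norm x < real k * norm ?d"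
        using reals_Archimedean3 by blast
      with bound[of k] show False
        by simp
    qed
    then show ?thesis
      by simp
  qed
qed

text \<open>Since \<open>g 0 = 0\<close>, preserving midpoints means additivity inside the ball. The
  extension shrinks \<open>x\<close> into the ball by an integer factor, applies \<open>g\<close>
  and scales back; additivity makes the factor irrelevant.\<close>

lemma linear_isometry_if_midpoint_isometry_ball:
  fixes g :: "'a::real_normed_vector \<Rightarrow> 'b::real_normed_vector"
  assumes "\<rho> > 0"
    and norm: "\<And>u. norm u < \<rho> \<Longrightarrow> norm (g u) = norm u"
    and mid: "\<And>u v. norm u < \<rho> \<Longrightarrow> norm v < \<rho> \<Longrightarrow> g (midpoint u v) = midpoint (g u) (g v)"
  obtains A where "linear A" "\<And>x. norm (A x) = norm x" "\<And>u. norm u < \<rho> \<Longrightarrow> g u = A u"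
proof -
  have zero: "g 0 = 0"
    using norm[of 0] \<open>\<rho> > 0\<close> by simp
  have half: "g ((1/2) *\<^sub>R u) = (1/2) *\<^sub>R g u" if "norm u < \<rho>" for u
    using mid[OF that, of 0] \<open>\<rho> > 0\<close> by (simp add: midpoint_def zero)
  have add: "g (u + v) = g u + g v" if "norm u < \<rho>" "norm v < \<rho>" "norm (u + v) < \<rho>" for u v
    using mid[OF that(1,2)] half[OF that(3)] by (simp add: midpoint_def)
  have nat: "g (real n *\<^sub>R u) = real n *\<^sub>R g u" if "real n * norm u < \<rho>" for n u
    using that
  proof (induction n)
    case (Suc n)
    have u: "norm u < \<rho>" and nu: "real n * norm u < \<rho>"
      using Suc.prems norm_ge_zero[of u] mult_nonneg_nonneg[OF of_nat_0_le_iff[of n] norm_ge_zero[of u]]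
      unfolding of_nat_Suc distrib_right by linarith+
    have "g (u + real n *\<^sub>R u) = g u + g (real n *\<^sub>R u)"
    proof (rule add)
      have "u + real n *\<^sub>R u = real (Suc n) *\<^sub>R u"
        by (simp add: scaleR_add_left)
      then show "norm (u + real n *\<^sub>R u) < \<rho>"
        using Suc.prems by (metis norm_scaleR abs_of_nat)
    qed (use u nu in simp_all)
    then show ?case
      using Suc.IH[OF nu] by (simp add: scaleR_add_left)
  qed (simp add: zero)
  define K where "K x = nat \<lfloor>norm x / \<rho>\<rfloor> + 1" for x :: 'a
  define A where "A x = real (K x) *\<^sub>R g (x /\<^sub>R real (K x))" for x
  have K: "norm x < real (K x) * \<rho>" for x
  proof -
    have "norm x / \<rho> < real (K x)"
      unfolding K_def by linarith
    then show ?thesis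
      using \<open>\<rho> > 0\<close> by (simp add: pos_divide_less_eq)
  qed
  have A: "A x = real n *\<^sub>R g (x /\<^sub>R real n)" if n: "norm x < real n * \<rho>" for n x
  proof -
    have "n > 0" "K x > 0"
      using n norm_ge_zero[of x] by (cases "n = 0") (simp_all add: K_def)
    \<comment> \<open>A common refinement of the two scales: both \<open>x /\<^sub>R real n\<close>
      and \<open>x /\<^sub>R real (K x)\<close> are integer multiples of \<open>y\<close> inside the
      ball.\<close>
    define y where "y = x /\<^sub>R (real n * real (K x))"
    have "real n *\<^sub>R y = x /\<^sub>R real (K x)" "real (K x) *\<^sub>R y = x /\<^sub>R real n"
      using \<open>n > 0\<close> \<open>K x > 0\<close> by (simp_all add: y_def field_simps)
    moreover have "real n * norm y < \<rho>" "real (K x) * norm y < \<rho>"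
      using \<open>n > 0\<close> \<open>K x > 0\<close> K[of x] n by (simp_all add: y_def field_simps)
    ultimately have "g (x /\<^sub>R real (K x)) = real n *\<^sub>R g y" "g (x /\<^sub>R real n) = real (K x) *\<^sub>R g y"
      using nat by metis+
    then show ?thesis
      by (simp add: A_def)
  qed
  have normA: "norm (A x) = norm x" for x
  proof -
    have "K x > 0"
      by (simp add: K_def)
    then have "norm (x /\<^sub>R real (K x)) < \<rho>"
      using K[of x] by (simp add: field_simps)
    then show ?thesis
      using \<open>K x > 0\<close> by (simp add: A_def norm)
  qed
  have addA: "A (x + y) = A x + A y" for x y
  proof -
    define n where "n = K x + K y"
    have "n > 0"
      by (simp add: n_def K_def)
    have "real n * \<rho> = real (K x) * \<rho> + real (K y) * \<rho>"
      by (simp add: n_def distrib_right)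
    moreover have "norm (x + y) \<le> norm x + norm y"
      by (rule norm_triangle_ineq)
    ultimately have less: "norm x < real n * \<rho>" "norm y < real n * \<rho>" "norm (x + y) < real n * \<rho>"
      using K[of x] K[of y] norm_ge_zero[of x] norm_ge_zero[of y] by linarith+
    have ball: "norm (z /\<^sub>R real n) < \<rho>" if "norm z < real n * \<rho>" for z :: 'a
      using that \<open>n > 0\<close> by (simp add: field_simps)
    have "g (x /\<^sub>R real n + y /\<^sub>R real n) = g (x /\<^sub>R real n) + g (y /\<^sub>R real n)"
      using less[THEN ball] by (intro add) (simp_all add: scaleR_add_right)
    then show ?thesis
      using less[THEN A] by (simp add: scaleR_add_right)
  qed
  have "g u = A u" if "norm u < \<rho>" for u
    using A[of u 1] that by simp
  with linear_if_additive_isometry[OF addA normA] normA show ?thesis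
    by (intro that)
qed

lemma dense_isometry_locally_affine:
  fixes \<psi> :: "'a::real_normed_vector \<Rightarrow> 'b::real_normed_vector"
  assumes iso: "\<And>x y. x \<in> V \<Longrightarrow> y \<in> V \<Longrightarrow> dist (\<psi> x) (\<psi> y) = dist x y"
    and "r > 0" and V: "ball p r \<subseteq> V" and dense: "ball (\<psi> p) r \<subseteq> closure (\<psi> ` V)"
  obtains A where "linear A" "\<And>x. norm (A x) = norm x"
    "\<And>x. dist x p < r / 4 \<Longrightarrow> \<psi> x = A (x - p) + \<psi> p"
proof -
  have "p \<in> V"
    using V \<open>r > 0\<close> by auto
  have inV: "x \<in> V" if "dist x p < r" for x
    using V that by (auto simp: dist_commute)
  have mid: "\<psi> (midpoint a b) = midpoint (\<psi> a) (\<psi> b)" if a: "dist a p < r / 4" and b: "dist b p < r / 4" for a b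
  \<comment> \<open>For \<open>a\<close>, \<open>b\<close> within \<open>r / 4\<close> of
    \<open>p\<close> and \<open>x\<close> within \<open>r / 2\<close> of both, \<open>x\<close> and
    the reflected image stay within \<open>3/4 * r\<close> of \<open>p\<close> and
    \<open>\<psi> p\<close>, where \<open>V\<close> and the density are available.\<close>
  proof (rule dense_isometry_midpoint[OF iso, where R = "r / 2"])
    show "a \<in> V" "b \<in> V"
      using a b \<open>r > 0\<close> by (auto intro!: inV)
    show "dist a b / 2 < r / 2"
      using dist_triangle2[of a b p] a b \<open>r > 0\<close> by linarith
    fix x assume x: "dist x a < r / 2" "dist x b < r / 2"
    show "x \<in> V"
      using dist_triangle[of x p a] x a \<open>r > 0\<close> by (intro inV) linarith
    then have "dist (\<psi> a) (\<psi> x) = dist x a" "dist (\<psi> b) (\<psi> p) = dist b p"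
      using iso \<open>a \<in> V\<close> \<open>b \<in> V\<close> \<open>p \<in> V\<close> by (simp_all add: dist_commute)
    moreover have "dist (\<psi> p) (\<psi> a + \<psi> b - \<psi> x) \<le> dist (\<psi> a) (\<psi> x) + dist (\<psi> b) (\<psi> p)"
    proof -
      have "\<psi> p - (\<psi> a + \<psi> b - \<psi> x) = - ((\<psi> a - \<psi> x) + (\<psi> b - \<psi> p))"
        by simp
      then show ?thesis
        unfolding dist_norm by (metis norm_minus_cancel norm_triangle_ineq)
    qed
    ultimately have "dist (\<psi> p) (\<psi> a + \<psi> b - \<psi> x) < r"
      using x(1) b \<open>r > 0\<close> by linarith
    then show "\<psi> a + \<psi> b - \<psi> x \<in> closure (\<psi> ` V)"
      using dense by auto
  qed
  define g where "g u = \<psi> (p + u) - \<psi> p" for u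
  have "norm (g u) = norm u" if "norm u < r / 4" for u
    using iso[OF inV \<open>p \<in> V\<close>, of "p + u"] that \<open>r > 0\<close> by (simp add: g_def dist_norm)
  moreover have "g (midpoint u v) = midpoint (g u) (g v)" if "norm u < r / 4" "norm v < r / 4" for u v
  proof -
    have "midpoint (p + u) (p + v) = p + midpoint u v"
      by (simp add: midpoint_def scaleR_add_right flip: scaleR_add_left)
    with mid[of "p + u" "p + v"] that
    have "\<psi> (p + midpoint u v) = midpoint (\<psi> (p + u)) (\<psi> (p + v))"
      by (simp add: dist_norm)
    moreover have "(1/2) *\<^sub>R \<psi> p + (1/2) *\<^sub>R \<psi> p = \<psi> p"
      by (simp flip: scaleR_add_left)
    ultimately show ?thesis
      by (simp add: g_def midpoint_def algebra_simps)
  qed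
  moreover have "r / 4 > 0"
    using \<open>r > 0\<close> by simp
  ultimately obtain A where A: "linear A" "\<And>x. norm (A x) = norm x"
    "\<And>u. norm u < r / 4 \<Longrightarrow> g u = A u"
    using linear_isometry_if_midpoint_isometry_ball[of "r / 4" g] by blast
  have "\<psi> x = A (x - p) + \<psi> p" if "dist x p < r / 4" for x
    using A(3)[of "x - p"] that by (simp add: g_def dist_norm diff_eq_eq)
  with A(1,2) show ?thesis
    by (intro that)
qed

subsection \<open>Propagation of the affine formula\<close>

text \<open>
  If \<open>c = q - w \<noteq> 0\<close>, then the norm is invariant under the shift by \<open>c\<close> on the ball of radius \<open>r\<close> about \<open>w\<close>.
  As \<open>norm w\<close> barely exceeds \<open>r\<close>, this ball contains points \<open>w / 5 + j c\<close> with \<open>norm (j c)\<close> much larger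
  than \<open>norm w / 5\<close>, whereas the invariance gives them all the norm \<open>norm w / 5\<close>.
\<close>

lemma eq_of_equidistant_from_ball:
  fixes w q :: "'a::real_normed_vector"
  assumes eq: "\<And>v. norm v < r \<Longrightarrow> norm (w - v) = norm (q - v)"
    and w: "norm w < 11/10 * r"
  shows "w = q"
proof (rule ccontr)
  assume "w \<noteq> q"
  define c where "c = q - w"
  have c: "norm c > 0"
    using \<open>w \<noteq> q\<close> by (simp add: c_def)
  have r: "r > 0"
    using w norm_ge_zero[of w] by linarith
  have shift: "norm (z + c) = norm z" if "norm (w - z) < r" for z
    using eq[of "w - z"] that by (simp add: c_def algebra_simps)
  \<comment> \<open>The points \<open>w - j c\<close> lie within \<open>r\<close> of
    \<open>w\<close> as long as the displacement does, so each step back preserves the norm.\<close>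
  have backward: "norm (w - real j *\<^sub>R c) = norm w" if "real j * norm c < r" for j
    using that
  proof (induction j)
    case (Suc j)
    have "real j * norm c < r"
      using Suc.prems c unfolding of_nat_Suc distrib_right by linarith
    moreover have "norm ((w - real (Suc j) *\<^sub>R c) + c) = norm (w - real (Suc j) *\<^sub>R c)"
      using Suc.prems by (intro shift) simp
    ultimately show ?case
      using Suc.IH by (simp add: algebra_simps)
  qed simp
  have forward: "norm ((1/5) *\<^sub>R w + real j *\<^sub>R c) = norm w / 5"
    if "\<And>i. i < j \<Longrightarrow> real i * norm c < 3/5 * r" for j
    using that
  proof (induction j)
    case (Suc j)
    let ?z = "(1/5) *\<^sub>R w + real j *\<^sub>R c"
    have j: "real j * norm c < 3/5 * r"
      using Suc.prems by simp
    \<comment> \<open>The constants fit exactly: with \<open>norm w < 11/10 * r\<close> and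
      \<open>real j * norm c < 3/5 * r\<close>, this splitting gives a norm below
      \<open>(22/25 + 3/25) * r = r\<close>.\<close>
    have "w - ?z = (4/5) *\<^sub>R (w - real j *\<^sub>R c) - (1/5) *\<^sub>R (real j *\<^sub>R c)"
      by (simp add: algebra_simps flip: scaleR_add_left) 
    then have "norm (w - ?z) \<le> 4/5 * norm (w - real j *\<^sub>R c) + 1/5 * (real j * norm c)"
      using norm_triangle_ineq4[of "(4/5) *\<^sub>R (w - real j *\<^sub>R c)" "(1/5) *\<^sub>R (real j *\<^sub>R c)"]
      by simp
    also have "norm (w - real j *\<^sub>R c) = norm w"
      using j r by (intro backward) linarith
    also have "4/5 * norm w + 1/5 * (real j * norm c) < r"
      using w j by linarith
    finally have "norm (?z + c) = norm ?z"
      by (rule shift)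
    then show ?case
      using Suc.IH Suc.prems by (simp add: algebra_simps)
  qed simp
  \<comment> \<open>The first index at which the total shift reaches \<open>3/5 * r\<close>; the
    triangle inequality would bound that shift by \<open>2/5 * norm w < 11/25 * r\<close>.\<close>
  define J where "J = (LEAST j. 3/5 * r \<le> real j * norm c)"
  obtain n where "3/5 * r / norm c \<le> real n"
    using real_arch_simple by blast
  then have "3/5 * r \<le> real n * norm c"
    using c by (simp add: pos_divide_le_eq)
  then have J: "3/5 * r \<le> real J * norm c"
    unfolding J_def by (rule LeastI)
  have "real i * norm c < 3/5 * r" if "i < J" for i
    using not_less_Least[of i "\<lambda>j. 3/5 * r \<le> real j * norm c"] that unfolding J_def by simp
  then have "norm ((1/5) *\<^sub>R w + real J *\<^sub>R c) = norm w / 5"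
    by (rule forward)
  moreover have "norm (real J *\<^sub>R c) \<le> norm ((1/5) *\<^sub>R w + real J *\<^sub>R c) + norm ((1/5) *\<^sub>R w)"
    using norm_triangle_ineq4[of "(1/5) *\<^sub>R w + real J *\<^sub>R c" "(1/5) *\<^sub>R w"] by simp
  ultimately show False
    using J w r by simp
qed

text \<open>By density, \<open>\<phi> x\<close> and \<open>L x\<close> are equidistant from every
  point of a ball where the formula holds, so they coincide if \<open>\<phi> x\<close> is less than
  11/10 of the radius from its centre.\<close>

lemma affine_formula_extends_to_ball:
  fixes \<phi> L :: "'b \<Rightarrow> 'a::real_normed_vector"
  assumes dist: "\<And>x y. x \<in> V \<Longrightarrow> y \<in> V \<Longrightarrow> dist (\<phi> x) (\<phi> y) = dist (L x) (L y)"
    and dense: "ball u R \<subseteq> closure (\<phi> ` V)"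
    and "r > 0" and eq: "\<And>y. y \<in> V \<Longrightarrow> dist u (\<phi> y) < r \<Longrightarrow> \<phi> y = L y"
    and y: "y \<in> V" "dist u (\<phi> y) < R"
  shows "\<phi> y = L y"
proof -
  have grow: "\<phi> x = L x"
    if s: "s \<le> R" and eq: "\<And>y. y \<in> V \<Longrightarrow> dist u (\<phi> y) < s \<Longrightarrow> \<phi> y = L y"
      and x: "x \<in> V" "dist u (\<phi> x) < 11/10 * s" for s x
  proof -
    have equidist: "dist (\<phi> x) z = dist (L x) z" if z: "dist u z < s" for z
    proof -
      have "z \<in> closure (\<phi> ` V)"
        using z s dense by auto
      moreover have "z \<in> ball u s"
        using z by simp
      ultimately have "z \<in> closure (ball u s \<inter> \<phi> ` V)"
        using open_Int_closure_subset[OF open_ball] by blast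
      moreover have "ball u s \<inter> \<phi> ` V \<subseteq> {z. dist (\<phi> x) z = dist (L x) z}"
        using eq dist[OF x(1)] by auto
      moreover have "closed {z. dist (\<phi> x) z = dist (L x) z}"
        by (intro closed_Collect_eq continuous_intros)
      ultimately show ?thesis
        using closure_minimal by blast
    qed
    have "\<phi> x - u = L x - u"
    proof (rule eq_of_equidistant_from_ball)
      show "norm (\<phi> x - u) < 11/10 * s"
        using x(2) by (simp add: dist_norm norm_minus_commute)
      show "norm (\<phi> x - u - v) = norm (L x - u - v)" if "norm v < s" for v
        using equidist[of "u + v"] that by (simp add: dist_norm diff_diff_eq)
    qed
    then show ?thesis
      by simp
  qed
  \<comment> \<open>The radius grows geometrically but is capped at \<open>R\<close>, as density is
    only known in that ball.\<close>
  have "\<forall>y\<in>V. dist u (\<phi> y) < min R ((11/10) ^ n * r) \<longrightarrow> \<phi> y = L y" for n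
  proof (induction n)
    case 0
    then show ?case
      using eq by simp
  next
    case (Suc n)
    let ?s = "min R ((11/10) ^ n * r)"
    show ?case
    proof (intro ballI impI)
      fix y assume y: "y \<in> V" "dist u (\<phi> y) < min R ((11/10) ^ Suc n * r)"
      then have "0 < R"
        using zero_le_dist[of u "\<phi> y"] by linarith
      then have "dist u (\<phi> y) < 11/10 * ?s"
        using y(2) by (auto simp: min_def split: if_splits)
      then show "\<phi> y = L y"
        using Suc.IH y(1) by (intro grow[of ?s y]) (simp, blast+)
    qed
  qed
  moreover obtain n where "R / r < (11/10) ^ n"
    using real_arch_pow[of "11/10" "R / r"] by auto
  then have "R < (11/10) ^ n * r"
    using \<open>r > 0\<close> by (simp add: pos_divide_less_eq)
  ultimately show ?thesis
    using y by (metis min.absorb1 less_imp_le)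
qed

text \<open>The set \<open>G\<close> of centres around which the formula holds is open, and so is
  \<open>U - G\<close> because radii of validity can be enlarged; connectedness of \<open>U\<close>
  then gives \<open>U \<subseteq> G\<close>.\<close>

lemma affine_formula_extends_to_connected:
  fixes \<phi> L :: "'b \<Rightarrow> 'a::real_normed_vector"
  assumes dist: "\<And>x y. x \<in> V \<Longrightarrow> y \<in> V \<Longrightarrow> dist (\<phi> x) (\<phi> y) = dist (L x) (L y)"
    and U: "open U" "connected U" "U \<subseteq> closure (\<phi> ` V)"
    and "p \<in> U" "r > 0" and eq: "\<And>y. y \<in> V \<Longrightarrow> dist p (\<phi> y) < r \<Longrightarrow> \<phi> y = L y"
    and y: "y \<in> V" "\<phi> y \<in> U"
  shows "\<phi> y = L y"
proof -
  define Q where "Q u s \<longleftrightarrow> s > 0 \<and> (\<forall>y\<in>V. dist u (\<phi> y) < s \<longrightarrow> \<phi> y = L y)" for u s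
  define G where "G = {u. \<exists>s. Q u s}"
  have near: "Q u (s - dist u v)" if "Q v s" "dist u v < s" for u v s
    using that unfolding Q_def by (smt (verit) dist_triangle2 dist_commute)
  have "open G"
    unfolding open_dist
  proof
    fix u assume "u \<in> G"
    then obtain s where s: "Q u s"
      by (auto simp: G_def)
    then have "\<forall>v. dist v u < s \<longrightarrow> v \<in> G"
      using near by (auto simp: G_def)
    then show "\<exists>e>0. \<forall>v. dist v u < e \<longrightarrow> v \<in> G"
      using s by (auto simp: Q_def)
  qed
  moreover have "open (U - G)"
    unfolding open_dist
  proof
    fix u assume u: "u \<in> U - G"
    then obtain R where "R > 0" and R: "ball u R \<subseteq> U"
      using U(1) openE by blast
    \<comment> \<open>The ball of radius \<open>R / 2\<close> about \<open>v\<close> lies in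
      \<open>U\<close> and contains \<open>u\<close>. Any radius of validity at \<open>v\<close>
      would grow to \<open>R / 2\<close> and so put \<open>u\<close> into \<open>G\<close>.\<close>
    have "v \<in> U - G" if v: "dist v u < R / 2" for v
    proof -
      have "ball v (R / 2) \<subseteq> ball u R"
      proof
        fix w assume "w \<in> ball v (R / 2)"
        then show "w \<in> ball u R"
          using v dist_triangle[of u w v] unfolding mem_ball dist_commute[of v u] by linarith
      qed
      then have sub: "ball v (R / 2) \<subseteq> U"
        using R by blast
      have "\<not> Q v s" for s
      proof
        assume s: "Q v s"
        have "\<phi> y = L y" if "y \<in> V" "dist v (\<phi> y) < R / 2" for y
        proof (rule affine_formula_extends_to_ball[of V \<phi> L v "R / 2" s])
          show "ball v (R / 2) \<subseteq> closure (\<phi> ` V)"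
            using sub U(3) by blast
        qed (use dist s that in \<open>auto simp: Q_def\<close>)
        then have "Q v (R / 2)"
          using \<open>R > 0\<close> by (simp add: Q_def)
        then have "Q u (R / 2 - dist u v)"
          using v by (intro near) (simp_all add: dist_commute)
        with u show False
          by (auto simp: G_def)
      qed
      moreover have "v \<in> U"
        using sub \<open>R > 0\<close> by auto
      ultimately show ?thesis
        by (simp add: G_def)
    qed
    then show "\<exists>e>0. \<forall>v. dist v u < e \<longrightarrow> v \<in> U - G"
      using \<open>R > 0\<close> by (intro exI[of _ "R / 2"]) auto
  qed
  moreover have "p \<in> G"
    using eq \<open>r > 0\<close> by (auto simp: G_def Q_def)
  ultimately have "U \<subseteq> G"
    using connectedD[OF U(2), of G "U - G"] \<open>p \<in> U\<close> by blast
  with y obtain s where "Q (\<phi> y) s"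
    by (auto simp: G_def)
  with y(1) show ?thesis
    by (auto simp: Q_def)
qed

text \<open>Rescaling by \<open>inverse \<alpha>\<close> gives an isometry, affine near a point of
  \<open>interior V\<close> whose image is in \<open>U\<close>. The formula spreads over
  \<open>U\<close> and then, by continuity, to points with image in
  \<open>closure U\<close>.\<close>

lemma dense_similarity_affine:
  fixes \<phi> :: "'b::real_normed_vector \<Rightarrow> 'a::real_normed_vector"
  assumes "\<alpha> > 0" and dist: "\<And>x y. x \<in> V \<Longrightarrow> y \<in> V \<Longrightarrow> dist (\<phi> x) (\<phi> y) = \<alpha> * dist x y"
    and U: "open U" "connected U" "U \<noteq> {}"
    and \<phi>U: "\<phi> ` V \<subseteq> closure U" and dense: "U \<subseteq> closure (\<phi> ` V)"
    and V: "V \<subseteq> closure (interior V)"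
  obtains A b where "linear A" "\<And>x. norm (A x) = norm x" "closure (range A) = UNIV"
    "\<And>y. y \<in> V \<Longrightarrow> \<phi> y = \<alpha> *\<^sub>R A y + b"
proof -
  \<comment> \<open>The local result needs a ball inside \<open>V\<close>, so the open set
    \<open>U\<close> has to meet the image of \<open>interior V\<close>, not just that of
    \<open>V\<close>.\<close>
  have dense_int: "closure (\<phi> ` V) \<subseteq> closure (\<phi> ` interior V)"
  proof (intro closure_minimal closed_closure subsetI)
    fix z assume "z \<in> \<phi> ` V"
    then obtain y where y: "y \<in> V" "z = \<phi> y"
      by blast
    have "\<exists>x\<in>interior V. dist (\<phi> x) z < e" if "e > 0" for e
    proof -
      obtain x where x: "x \<in> interior V" "dist x y < e / \<alpha>"
        using y(1) V \<open>e > 0\<close> \<open>\<alpha> > 0\<close> by (metis closure_approachable divide_pos_pos subsetD)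
      then have "dist (\<phi> x) (\<phi> y) < e"
        using dist[of x y] y(1) \<open>\<alpha> > 0\<close> subsetD[OF interior_subset x(1)]
        by (simp add: pos_less_divide_eq mult.commute)
      with x(1) y(2) show ?thesis
        by blast
    qed
    then show "z \<in> closure (\<phi> ` interior V)"
      by (simp add: closure_approachable)
  qed
  have "U \<inter> closure (\<phi> ` interior V) \<noteq> {}"
    using U(3) dense dense_int by blast
  then have "U \<inter> \<phi> ` interior V \<noteq> {}"
    using open_Int_closure_eq_empty[OF U(1)] by blast
  then obtain p where p: "p \<in> interior V" "\<phi> p \<in> U"
    by blast
  obtain r1 where r1: "r1 > 0" "ball p r1 \<subseteq> V"
    using p(1) by (auto simp: mem_interior)
  obtain r2 where r2: "r2 > 0" "ball (\<phi> p) r2 \<subseteq> U"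
    using p(2) U(1) openE by blast
  define r where "r = min r1 (r2 / \<alpha>)"
  have "r \<le> r1" "\<alpha> * r \<le> r2" "r > 0"
    using r1(1) r2(1) \<open>\<alpha> > 0\<close> by (auto simp: r_def min_def field_simps)
  then have r: "ball p r \<subseteq> V" "ball (\<phi> p) (\<alpha> * r) \<subseteq> U"
    using r1(2) r2(2) subset_ball by blast+
  define \<psi> where "\<psi> x = inverse \<alpha> *\<^sub>R \<phi> x" for x
  have \<phi>: "\<phi> x = \<alpha> *\<^sub>R \<psi> x" for x
    using \<open>\<alpha> > 0\<close> by (simp add: \<psi>_def)
  have iso: "dist (\<psi> x) (\<psi> y) = dist x y" if "x \<in> V" "y \<in> V" for x y
    using dist[OF that] \<open>\<alpha> > 0\<close> by (simp add: \<phi> dist_norm flip: scaleR_diff_right)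
  have "ball (\<psi> p) r \<subseteq> closure (\<psi> ` V)"
  proof
    fix z assume "z \<in> ball (\<psi> p) r"
    then have "\<alpha> *\<^sub>R z \<in> ball (\<phi> p) (\<alpha> * r)"
      using \<open>\<alpha> > 0\<close> by (simp add: \<phi> dist_norm flip: scaleR_diff_right)
    then have "\<alpha> *\<^sub>R z \<in> closure (\<phi> ` V)"
      using r(2) dense by blast
    then have "inverse \<alpha> *\<^sub>R \<alpha> *\<^sub>R z \<in> (*\<^sub>R) (inverse \<alpha>) ` closure (\<phi> ` V)"
      by (rule imageI)
    also have "\<dots> = closure (\<psi> ` V)"
      by (simp add: closure_scaleR image_image \<psi>_def)
    finally show "z \<in> closure (\<psi> ` V)"
      using \<open>\<alpha> > 0\<close> by simp
  qed
  then obtain A where A: "linear A" "\<And>x. norm (A x) = norm x"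
    and loc: "\<And>x. dist x p < r / 4 \<Longrightarrow> \<psi> x = A (x - p) + \<psi> p"
    using dense_isometry_locally_affine[OF iso \<open>r > 0\<close> r(1)] by blast
  interpret A: linear A
    by (rule A(1))
  define b where "b = \<phi> p - \<alpha> *\<^sub>R A p"
  define L where "L y = \<alpha> *\<^sub>R A y + b" for y
  have distA: "dist (A x) (A y) = dist x y" for x y
    by (simp add: dist_norm A(2) flip: A.diff)
  have distL: "dist (L x) (L y) = \<alpha> * dist x y" for x y
    using \<open>\<alpha> > 0\<close> by (simp add: L_def dist_norm flip: scaleR_diff_right A.diff) (simp add: A(2))
  have \<phi>L_loc: "\<phi> y = L y" if "y \<in> V" "dist (\<phi> p) (\<phi> y) < \<alpha> * (r / 4)" for y
  proof -
    have "p \<in> V"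
      using p(1) interior_subset by blast
    then have "dist y p < r / 4"
      using that(2) dist[OF \<open>p \<in> V\<close> that(1)] \<open>\<alpha> > 0\<close> by (simp add: dist_commute)
    then show ?thesis
      using loc[of y] by (simp add: \<phi> L_def b_def A.diff scaleR_add_right scaleR_diff_right)
  qed
  have \<phi>L_U: "\<phi> y = L y" if "y \<in> V" "\<phi> y \<in> U" for y
    using affine_formula_extends_to_connected[of V \<phi> L U "\<phi> p" "\<alpha> * (r / 4)" y]
      dist distL U dense p(2) \<open>r > 0\<close> \<open>\<alpha> > 0\<close> \<phi>L_loc that by simp
  \<comment> \<open>If \<open>\<phi> y\<close> is only in \<open>closure U\<close>, it is
    approximated by values \<open>\<phi> x\<close> in \<open>U\<close>, where the formula holds;
    \<phi> and \<open>L\<close> scale distances alike, whence the factor 2.\<close>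
  have \<phi>L: "\<phi> y = L y" if y: "y \<in> V" for y
  proof -
    have "U \<subseteq> closure (U \<inter> \<phi> ` V)"
      using dense open_Int_closure_subset[OF U(1)] by blast
    then have "\<phi> y \<in> closure (U \<inter> \<phi> ` V)"
      using y \<phi>U closure_minimal[OF _ closed_closure] by blast
    moreover have "dist (\<phi> y) (L y) \<le> 2 * dist (\<phi> x) (\<phi> y)" if x: "x \<in> V" "\<phi> x \<in> U" for x
      using dist_triangle2[of "\<phi> y" "L y" "L x"] \<phi>L_U[OF x] distL[of x y] dist[OF x(1) y]
      by (simp add: dist_commute)
    ultimately have "dist (\<phi> y) (L y) \<le> e" if "e > 0" for e
      using half_gt_zero[OF that] unfolding closure_approachable by fastforce
    then show ?thesis
      by (metis dense_ge dist_le_zero_iff)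
  qed
  moreover have "closure (range A) = UNIV"
  proof (rule UNIV_eq_I[symmetric])
    fix z :: 'a
    \<comment> \<open>Moves \<open>z\<close> into the ball about \<open>\<phi> p\<close> where the
      image is dense; an image point \<open>\<phi> y\<close> near
      \<open>\<phi> p + t *\<^sub>R z\<close> then yields an argument
      \<open>(\<alpha> / t) *\<^sub>R (y - p)\<close> whose value under \<open>A\<close> is near
      \<open>z\<close>.\<close>
    define t where "t = \<alpha> * r / 2 / (norm z + 1)"
    have "t > 0"
      using \<open>\<alpha> > 0\<close> \<open>r > 0\<close> by (simp add: t_def add_nonneg_pos)
    have "t * norm z < \<alpha> * r"
    proof -
      have "t * norm z \<le> t * (norm z + 1)"
        using \<open>t > 0\<close> by simp
      also have "\<dots> = \<alpha> * r / 2"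
        unfolding t_def using norm_ge_zero[of z] by (intro nonzero_eq_divide_eq[THEN iffD1, OF _ refl]) linarith
      also have "\<dots> < \<alpha> * r"
        using \<open>\<alpha> > 0\<close> \<open>r > 0\<close> by simp
      finally show ?thesis .
    qed
    then have "\<phi> p + t *\<^sub>R z \<in> ball (\<phi> p) (\<alpha> * r)"
      using \<open>t > 0\<close> by (simp add: dist_norm)
    then have tz: "\<phi> p + t *\<^sub>R z \<in> closure (\<phi> ` V)"
      using r(2) dense by blast
    have "\<exists>x. dist (A x) z < e" if "e > 0" for e
    proof -
      obtain y where y: "y \<in> V" "dist (\<phi> y) (\<phi> p + t *\<^sub>R z) < t * e"
        using tz \<open>t > 0\<close> \<open>e > 0\<close> unfolding closure_approachable
        by (metis imageE mult_pos_pos)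
      let ?x = "(\<alpha> / t) *\<^sub>R (y - p)"
      have "\<phi> y - \<phi> p = \<alpha> *\<^sub>R A (y - p)"
        using \<phi>L[OF y(1)] by (simp add: L_def b_def A.diff scaleR_diff_right)
      moreover have "t *\<^sub>R A ?x = \<alpha> *\<^sub>R A (y - p)"
        using \<open>t > 0\<close> unfolding A.scale by simp
      ultimately have "\<phi> y - (\<phi> p + t *\<^sub>R z) = t *\<^sub>R (A ?x - z)"
        by (simp add: scaleR_diff_right diff_diff_eq[symmetric])
      then have "t * dist (A ?x) z < t * e"
        using y(2) \<open>t > 0\<close> by (simp add: dist_norm)
      then show ?thesis
        using \<open>t > 0\<close> by auto
    qed
    then show "z \<in> closure (range A)"
      by (auto simp: closure_approachable)
  qed
  ultimately show ?thesis
    using A(1,2) that by (auto simp: L_def)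
qed

text \<open>A homothety centred at \<open>x\<close> with ratio \<open>t\<close> maps the interior to
  an open subset of \<open>S\<close>; its image of \<open>c\<close> tends to \<open>x\<close> as
  \<open>t\<close> tends to 0.\<close>

lemma convex_subset_closure_interior:
  fixes S :: "'a::real_normed_vector set"
  assumes "convex S" "interior S \<noteq> {}"
  shows "S \<subseteq> closure (interior S)"
proof
  fix x assume "x \<in> S"
  obtain c where c: "c \<in> interior S"
    using assms(2) by blast
  have "(1 - t) *\<^sub>R x + t *\<^sub>R c \<in> interior S" if t: "0 < t" "t < 1" for t
  proof (rule interiorI)
    show "open ((\<lambda>y. (1 - t) *\<^sub>R x + t *\<^sub>R y) ` interior S)"
      using t by (intro open_affinity) auto
    show "(1 - t) *\<^sub>R x + t *\<^sub>R c \<in> (\<lambda>y. (1 - t) *\<^sub>R x + t *\<^sub>R y) ` interior S"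
      using c by blast
    show "(\<lambda>y. (1 - t) *\<^sub>R x + t *\<^sub>R y) ` interior S \<subseteq> S"
      using \<open>x \<in> S\<close> t interior_subset[of S] by (auto intro!: convexD[OF assms(1)])
  qed
  then have "\<forall>\<^sub>F t in at_right 0. (1 - t) *\<^sub>R x + t *\<^sub>R c \<in> closure (interior S)"
    using closure_subset by (intro eventually_at_rightI[of _ 1]) auto
  moreover have "((\<lambda>t. (1 - t) *\<^sub>R x + t *\<^sub>R c) \<longlongrightarrow> (1 - 0) *\<^sub>R x + 0 *\<^sub>R c) (at_right 0)"
    by (intro tendsto_intros)
  ultimately show "x \<in> closure (interior S)"
    using Lim_in_closed_set[OF closed_closure _ trivial_limit_at_right_real] by fastforce
qed

subsection \<open>Isometric weighted composition operators\<close>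

lemma Lip_const_le_iff:
  assumes "K \<ge> 0"
  shows "Lip_const X f \<le> ennreal K \<longleftrightarrow> (\<forall>x\<in>X. \<forall>y\<in>X. \<bar>f x - f y\<bar> \<le> K * dist x y)"
proof -
  have "ennreal (\<bar>f x - f y\<bar> / dist x y) \<le> ennreal K \<longleftrightarrow> \<bar>f x - f y\<bar> \<le> K * dist x y" if "x \<noteq> y" for x y
    using that assms by (simp add: pos_divide_le_eq ennreal_le_iff)
  then show ?thesis
    unfolding Lip_const_def SUP_le_iff by (auto 0 3)
qed

lemma Lip_const_leD:
  assumes "Lip_const X f \<le> ennreal K" "K \<ge> 0" "x \<in> X" "y \<in> X"
  shows "\<bar>f x - f y\<bar> \<le> K * dist x y"
  using assms Lip_const_le_iff by blast

lemma restrict_in_Lip: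
  assumes "K \<ge> 0" and "\<And>x y. x \<in> X \<Longrightarrow> y \<in> X \<Longrightarrow> \<bar>f x - f y\<bar> \<le> K * dist x y"
  shows "restrict f X \<in> Lip X" "Lip_const X (restrict f X) \<le> ennreal K"
proof -
  show le: "Lip_const X (restrict f X) \<le> ennreal K"
    using assms by (simp add: Lip_const_le_iff)
  show "restrict f X \<in> Lip X"
    using le_less_trans[OF le ennreal_less_top] by (simp add: Lip_def)
qed

lemma restrict_dist_in_Lip:
  shows "restrict (dist z) X \<in> Lip X" "Lip_const X (restrict (dist z) X) \<le> ennreal 1"
proof -
  have "\<bar>dist z x - dist z y\<bar> \<le> 1 * dist x y" for x y
    using abs_dist_diff_le[of x z y] by (simp add: dist_commute)
  then show "restrict (dist z) X \<in> Lip X" "Lip_const X (restrict (dist z) X) \<le> ennreal 1"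
    using restrict_in_Lip[of 1 X "dist z"] by simp_all
qed

text \<open>Collects what the isometry and bijectivity of the operator contribute; what remains is a
  geometric question about \<phi>.\<close>

lemma weighted_comp_isometry_similarity:
  fixes U :: "'a::metric_space set" and V :: "'b::metric_space set"
  assumes "U \<noteq> {}" and \<phi>: "\<phi> ` V \<subseteq> U"
    and bij: "bij_betw (weighted_comp V h \<phi>) (Lip U) (Lip V)"
    and iso: "\<And>f. f \<in> Lip U \<Longrightarrow> Lip_const V (weighted_comp V h \<phi> f) = Lip_const U f"
  obtains c where "c \<noteq> 0" "\<And>y. y \<in> V \<Longrightarrow> h y = c"
    "\<And>x y. x \<in> V \<Longrightarrow> y \<in> V \<Longrightarrow> dist x y = \<bar>c\<bar> * dist (\<phi> x) (\<phi> y)"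
    "U \<subseteq> closure (\<phi> ` V)"
proof -
  let ?T = "weighted_comp V h \<phi>"
  have T: "?T f y = h y * f (\<phi> y)" if "y \<in> V" for f y
    using that by (simp add: weighted_comp_def)
  have inj: "f = g" if "f \<in> Lip U" "g \<in> Lip U" "?T f = ?T g" for f g
    using bij that by (auto simp: bij_betw_def inj_on_def)
  have const: "(\<lambda>x\<in>U. a) \<in> Lip U" "Lip_const U (\<lambda>x\<in>U. a) \<le> ennreal 0" for a :: real
    using restrict_in_Lip[of 0 U "\<lambda>_. a"] by simp_all
  have TeqI: "?T f = ?T g" if "\<And>y. y \<in> V \<Longrightarrow> h y * f (\<phi> y) = h y * g (\<phi> y)" for f g
    using that by (auto simp: weighted_comp_def)
  have T01: "?T (\<lambda>x\<in>U. 0) \<noteq> ?T (\<lambda>x\<in>U. 1)"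
  proof
    assume "?T (\<lambda>x\<in>U. 0) = ?T (\<lambda>x\<in>U. 1)"
    then have "(\<lambda>x\<in>U. 0 :: real) = (\<lambda>x\<in>U. 1)"
      by (intro inj const)
    with \<open>U \<noteq> {}\<close> show False
      by (metis restrict_apply' equals0I zero_neq_one)
  qed
  then obtain y0 where "y0 \<in> V"
    using TeqI[of "\<lambda>x\<in>U. 0" "\<lambda>x\<in>U. 1"] by blast
  define c where "c = h y0"
  have hc: "h y = c" if "y \<in> V" for y
  proof -
    have "Lip_const V (?T (\<lambda>x\<in>U. 1)) \<le> ennreal 0"
      using iso[OF const(1)] const(2) by simp
    then have "\<bar>?T (\<lambda>x\<in>U. 1) y - ?T (\<lambda>x\<in>U. 1) y0\<bar> \<le> 0 * dist y y0"
      using Lip_const_leD[OF _ order_refl that \<open>y0 \<in> V\<close>] by blast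
    then show ?thesis
      using that \<open>y0 \<in> V\<close> \<phi> by (simp add: T c_def image_subset_iff)
  qed
  have "c \<noteq> 0"
    using T01 TeqI[of "\<lambda>x\<in>U. 0" "\<lambda>x\<in>U. 1"] hc by auto
  have dist: "dist x y = \<bar>c\<bar> * dist (\<phi> x) (\<phi> y)" if x: "x \<in> V" and y: "y \<in> V" for x y
  proof (rule antisym)
    have \<phi>xy: "\<phi> x \<in> U" "\<phi> y \<in> U"
      using x y \<phi> by auto
    let ?f = "restrict (dist (\<phi> y)) U"
    have f: "?f \<in> Lip U" "Lip_const U ?f \<le> ennreal 1"
      by (rule restrict_dist_in_Lip)+
    then have "Lip_const V (?T ?f) \<le> ennreal 1"
      by (simp add: iso)
    then have "\<bar>?T ?f x - ?T ?f y\<bar> \<le> 1 * dist x y"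
      using Lip_const_leD[OF _ zero_le_one x y] by blast
    then show "\<bar>c\<bar> * dist (\<phi> x) (\<phi> y) \<le> dist x y"
      using x y \<phi>xy by (simp add: T hc abs_mult dist_commute)
    \<comment> \<open>For the reverse inequality, surjectivity supplies a preimage of the distance
      function on \<open>V\<close>, again with Lipschitz constant at most 1.\<close>
    let ?g = "restrict (dist y) V"
    have g: "?g \<in> Lip V" "Lip_const V ?g \<le> ennreal 1"
      by (rule restrict_dist_in_Lip)+
    then obtain f where f: "f \<in> Lip U" "?T f = ?g"
      using bij unfolding bij_betw_def by (metis imageE)
    then have "Lip_const U f \<le> ennreal 1"
      using g(2) iso by metis
    then have "\<bar>f (\<phi> x) - f (\<phi> y)\<bar> \<le> 1 * dist (\<phi> x) (\<phi> y)"
      using Lip_const_leD[OF _ zero_le_one \<phi>xy] by blast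
    moreover have "dist x y = \<bar>?T f x - ?T f y\<bar>"
      using x y by (simp add: f(2) dist_commute)
    then have "dist x y = \<bar>c\<bar> * \<bar>f (\<phi> x) - f (\<phi> y)\<bar>"
      using x y by (simp add: T hc flip: abs_mult right_diff_distrib)
    ultimately show "dist x y \<le> \<bar>c\<bar> * dist (\<phi> x) (\<phi> y)"
      by (simp add: mult_left_mono)
  qed
  have "U \<subseteq> closure (\<phi> ` V)"
  proof
    fix u assume "u \<in> U"
    let ?f = "\<lambda>x\<in>U. infdist x (\<phi> ` V)"
    have "?T ?f = ?T (\<lambda>x\<in>U. 0)"
      using \<phi> by (intro TeqI) (auto simp: image_subset_iff)
    moreover have "?f \<in> Lip U"
      using infdist_triangle_abs by (intro restrict_in_Lip(1)[of 1]) simp_all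
    ultimately have "?f = (\<lambda>x\<in>U. 0)"
      by (intro inj const)
    then have "infdist u (\<phi> ` V) = 0"
      using \<open>u \<in> U\<close> by (metis restrict_apply')
    \<comment> \<open>The point \<open>y0\<close> matters: \<open>infdist\<close> to the empty set
      is 0 by convention.\<close>
    then show "u \<in> closure (\<phi> ` V)"
      using \<open>y0 \<in> V\<close> in_closure_iff_infdist_zero[of "\<phi> ` V" u] by blast
  qed
  with \<open>c \<noteq> 0\<close> hc dist show ?thesis
    by (rule that)
qed

theorem corollary2p4:
  fixes U :: "'e::real_normed_vector set" and V :: "'f::real_normed_vector set"
    and \<phi> :: "'f \<Rightarrow> 'e" and h :: "'f \<Rightarrow> real"
  assumes "(open U \<and> open V \<and> connected U \<and> U \<noteq> {}) \<or> (convex_body U \<and> convex_body V)"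
    and "\<phi> ` V \<subseteq> U"
    and "bij_betw (weighted_comp V h \<phi>) (Lip U) (Lip V)"
    and "\<forall>f\<in>Lip U. Lip_const V (weighted_comp V h \<phi> f) = Lip_const U f"
  shows "\<exists>(A :: 'f \<Rightarrow> 'e) (\<alpha> :: real) (b :: 'e) (s :: real).
      linear A \<and> (\<forall>x y. dist (A x) (A y) = dist x y) \<and> closure (range A) = UNIV \<and>
      \<alpha> > 0 \<and> s \<in> {1, -1} \<and>
      (\<forall>y\<in>V. \<phi> y = \<alpha> *\<^sub>R A y + b) \<and>
      (\<forall>y\<in>V. h y = s * inverse \<alpha>) \<and>
      (\<forall>f\<in>Lip U. \<forall>y\<in>V. weighted_comp V h \<phi> f y = s * inverse \<alpha> * f (\<alpha> *\<^sub>R A y + b))"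
proof -
  \<comment> \<open>Both alternatives of the hypothesis are reduced to the same topological
    conditions, with \<open>interior U\<close> as the open connected set.\<close>
  have U: "connected (interior U) \<and> interior U \<noteq> {} \<and> U \<subseteq> closure (interior U)"
    and V: "V \<subseteq> closure (interior V)"
    using assms(1)
    by (auto simp: convex_body_def interior_open convex_connected
        dest: subsetD[OF closure_subset] subsetD[OF convex_subset_closure_interior])
  have "U \<noteq> {}"
    using U interior_subset by blast
  with assms(2-4) obtain c where c: "c \<noteq> 0" "\<And>y. y \<in> V \<Longrightarrow> h y = c"
    and dist: "\<And>x y. x \<in> V \<Longrightarrow> y \<in> V \<Longrightarrow> dist x y = \<bar>c\<bar> * dist (\<phi> x) (\<phi> y)"
    and dense: "U \<subseteq> closure (\<phi> ` V)"
    using weighted_comp_isometry_similarity[of U \<phi> V h] by blast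
  have \<phi>U: "\<phi> ` V \<subseteq> closure (interior U)"
    using assms(2) U by blast
  have dense': "interior U \<subseteq> closure (\<phi> ` V)"
    using dense interior_subset by blast
  have dist': "dist (\<phi> x) (\<phi> y) = inverse \<bar>c\<bar> * dist x y" if "x \<in> V" "y \<in> V" for x y
    using dist[OF that] c(1) by simp
  \<comment> \<open>The scale \<alpha> is \<open>inverse \<bar>c\<bar>\<close> and the sign is
    \<open>sgn c\<close>, since \<open>c = sgn c * \<bar>c\<bar>\<close>.\<close>
  have "inverse \<bar>c\<bar> > 0"
    using c(1) by simp
  then obtain A b where A: "linear A" "\<And>x. norm (A x) = norm x" "closure (range A) = UNIV"
    and \<phi>: "\<And>y. y \<in> V \<Longrightarrow> \<phi> y = inverse \<bar>c\<bar> *\<^sub>R A y + b"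
    using dense_similarity_affine[OF _ dist' open_interior _ _ \<phi>U dense' V] U by blast
  have "dist (A x) (A y) = dist x y" for x y
    using A(2) by (simp add: dist_norm flip: linear_diff[OF A(1)])
  moreover have "h y = sgn c * inverse (inverse \<bar>c\<bar>)" if "y \<in> V" for y
    using c(2)[OF that] by (simp add: sgn_mult_abs)
  moreover have "weighted_comp V h \<phi> f y = sgn c * inverse (inverse \<bar>c\<bar>) * f (inverse \<bar>c\<bar> *\<^sub>R A y + b)"
    if "y \<in> V" for f y
    using that c(2) \<phi> by (simp add: weighted_comp_def sgn_mult_abs)
  moreover have "sgn c \<in> {1, -1}"
    using c(1) by (simp add: sgn_if)
  ultimately show ?thesis
    using A(1,3) \<phi> c(1)
    by (intro exI[of _ A] exI[of _ "inverse \<bar>c\<bar>"] exI[of _ b] exI[of _ "sgn c"]) auto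
qed

end
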